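(* Let $C_m=\frac{1}{m+1}\binom{2m}{m}$ denote the $m$-th Catalan number. Label the vertices of a regular convex $N$-gon by $0,1,\ldots,N-1$ in cyclic order. For vertices $x\neq y$, let $f_{xy}(N)$ denote the number of triangulations of this $N$-gon that contain no diagonal parallel to the segment $xy$. Then: (i) for every $n\ge 2$, $f_{01}(2n)=2C_{2n-3}$; (ii) for every $n\ge 2$, $f_{02}(2n)=C_{2n-1}+2C_{2n-2}-2^{2n-1}C_{n-1}$; (iii) for every $n\ge 1$, $f_{01}(2n+1)=2^{2n-1}C_{n-1}-C_{2n-1}$.
   Context: A triangulation of a convex $N$-gon is a maximal set of pairwise non-crossing diagonals (there are $N-3$ of them), viewed as a graph on the vertices $0,\ldots,N-1$ whose edges are the $N$ sides $01,12,\ldots,(N-1)0$ together with these diagonals; there are $C_{N-2}$ triangulations. Here $xy$ may be a side (e.g. $01$) or a diagonal (e.g. $02$) of the regular polygon, and "parallel" means parallel as line segments in the regular $N$-gon (equivalently, $ab$ is parallel to $cd$ iff $a+b\equiv c+d \pmod N$). *)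

theory Defs
  imports Main
begin

definition catalan :: "nat \<Rightarrow> nat" where
  "catalan m = (2 * m choose m) div (m + 1)"

text \<open>Vertices of the convex N-gon are 0..N-1 in cyclic order. A diagonal is
  encoded as a pair (a,b) with a < b, not a side (sides are (i,i+1) and (0,N-1)).\<close>
definition is_diagonal :: "nat \<Rightarrow> nat \<times> nat \<Rightarrow> bool" where
  "is_diagonal N d \<longleftrightarrow> (case d of (a, b) \<Rightarrow>
      a < b \<and> b < N \<and> b \<noteq> a + 1 \<and> \<not> (a = 0 \<and> b = N - 1))"

definition diagonals :: "nat \<Rightarrow> (nat \<times> nat) set" where
  "diagonals N = {d. is_diagonal N d}"

definition crosses :: "nat \<times> nat \<Rightarrow> nat \<times> nat \<Rightarrow> bool" where
  "crosses d e \<longleftrightarrow> (case d of (a, b) \<Rightarrow> case e of (c, e') \<Rightarrow>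
      (a < c \<and> c < b \<and> b < e') \<or> (c < a \<and> a < e' \<and> e' < b))"

definition triangulation :: "nat \<Rightarrow> (nat \<times> nat) set \<Rightarrow> bool" where
  "triangulation N T \<longleftrightarrow>
     T \<subseteq> diagonals N \<and>
     (\<forall>d\<in>T. \<forall>e\<in>T. \<not> crosses d e) \<and>
     (\<forall>d\<in>diagonals N - T. \<exists>e\<in>T. crosses d e)"

text \<open>Segment ab is parallel to cd in the regular N-gon iff a+b = c+d (mod N).\<close>
definition parallel :: "nat \<Rightarrow> nat \<times> nat \<Rightarrow> nat \<Rightarrow> nat \<Rightarrow> bool" where
  "parallel N d x y \<longleftrightarrow> (fst d + snd d) mod N = (x + y) mod N"

definition f_count :: "nat \<Rightarrow> nat \<Rightarrow> nat \<Rightarrow> nat" where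
  "f_count N x y = card {T. triangulation N T \<and> (\<forall>d\<in>T. \<not> parallel N d x y)}"

end

theory Submission
  imports Defs "HOL-Computational_Algebra.Formal_Power_Series"
begin

text \<open>
  A triangulation of the polygon on a finite vertex set \<open>V\<close> is treated as a maximal non-crossing set of
  all chords of \<open>V\<close>, sides included, so that cutting along a chord splits it into triangulations
  of two such polygons. In the regular \<open>N\<close>-gon the diagonals of a parallel class are nested; sorting
  triangulations by the innermost one they contain gives linear recurrences for the numbers of
  avoiding triangulations, where in case (ii) those containing \<open>02\<close> are counted separately. With \<open>C\<^sub>e\<close> and \<open>C\<^sub>o\<close> the generating functions of
  \<open>C\<^bsub>2n\<^esub>\<close> and \<open>C\<^bsub>2n+1\<^esub>\<close>, (i) and (iii) are the coefficients of \<open>(C\<^sub>e - 1) / C\<^sub>e\<close> and \<open>C\<^sub>o / C\<^sub>e\<close>,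
  and (ii) is \<open>C\<^bsub>2n-2\<^esub>\<close> minus a coefficient of \<open>C\<^sub>o\<^sup>2 / C\<^sub>e\<close>. These are
  evaluated by splitting \<open>C = 1 + x C\<^sup>2\<close> into its even and odd parts, which yields
  \<open>C\<^sub>e\<^sup>2 = C(4x)\<close> and \<open>C\<^sub>o / C\<^sub>e = 2 C\<^sub>e\<^sup>2 - C\<^sub>o\<close>.
\<close>

subsection \<open>Catalan numbers of even and odd index\<close>

lemma fps_nth_numeral_mult:
  "fps_nth (numeral k * f) n = numeral k * fps_nth (f :: 'a :: comm_ring_1 fps) n"
  by (simp add: fps_numeral_fps_const)

lemma sum_atMost_rev: "(\<Sum>i\<le>m. f (m - i) i) = (\<Sum>i\<le>m. f i (m - i))"
  for f :: "nat \<Rightarrow> nat \<Rightarrow> 'a :: comm_monoid_add"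
  by (rule sum.reindex_bij_witness[where i = "\<lambda>i. m - i" and j = "\<lambda>i. m - i"]) auto

section \<open>Catalan numbers through Segner's recurrence\<close>

fun segner :: "nat \<Rightarrow> nat" where
  "segner 0 = 1"
| "segner (Suc n) = (\<Sum>i\<le>n. segner i * segner (n - i))"

text \<open>With \<open>s = 1 - 2 x C(x)\<close> Segner's recurrence reads \<open>s\<^sup>2 = 1 - 4 x\<close>;
  differentiating gives \<open>(1 - 4 x) s' = -2 s\<close>, a first-order recurrence for the coefficients.\<close>

lemma segner_rec: "(n + 2) * segner (Suc n) = (4 * n + 2) * segner n"
proof -
  define C where "C = Abs_fps (\<lambda>n. int (segner n))"
  define s where "s = 1 - 2 * fps_X * C"
  have C: "C = 1 + fps_X * C * C"
  proof (rule fps_ext)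
    fix n show "fps_nth C n = fps_nth (1 + fps_X * C * C) n"
      by (cases n) (simp_all add: mult.assoc fps_mult_nth[of C C], simp_all add: C_def atLeast0AtMost)
  qed
  have sq: "s * s = 1 - 4 * fps_X"
  proof -
    have "s * s = 1 - 4 * fps_X * C + 4 * fps_X * (fps_X * C * C)"
      by (simp add: s_def algebra_simps)
    also have "fps_X * C * C = C - 1" using C by (simp add: algebra_simps)
    finally show ?thesis by (simp add: algebra_simps)
  qed
  have "fps_deriv (s * s) = - 4"
    by (simp add: sq)
  then have "2 * (s * fps_deriv s) = 2 * (- 2)"
    by (simp add: algebra_simps)
  then have d: "s * fps_deriv s = - 2"
    by (metis mult_left_cancel zero_neq_numeral)
  have "(1 - 4 * fps_X) * fps_deriv s = s * (s * fps_deriv s)"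
    by (simp add: sq[symmetric] mult.assoc)
  then have "(1 - 4 * fps_X) * fps_deriv s = - 2 * s" using d by simp
  then have "fps_deriv s - 4 * (fps_X * fps_deriv s) = - (2 * s)"
    by (simp add: algebra_simps)
  \<comment> \<open>Taking the coefficient at \<open>Suc n\<close> involves only coefficients of
    \<open>s\<close> of positive index, which are -2 times Segner numbers; the constant term 1 does
    not fit that pattern.\<close>
  then have "fps_nth (fps_deriv s - 4 * (fps_X * fps_deriv s)) (Suc n) = fps_nth (- (2 * s)) (Suc n)"
    by (simp only:)
  moreover have "fps_nth s (Suc k) = - 2 * int (segner k)" for k
    by (simp add: s_def C_def mult.assoc fps_nth_numeral_mult)
  ultimately have "int ((n + 2) * segner (Suc n)) = int ((4 * n + 2) * segner n)"
    by (simp add: fps_nth_numeral_mult del: segner.simps) (simp add: algebra_simps del: segner.simps)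
  then show ?thesis by (simp only: of_nat_eq_iff)
qed

lemma central_binomial_Suc: "Suc n * (2 * Suc n choose Suc n) = (4 * n + 2) * (2 * n choose n)"
proof -
  have "Suc n * (2 * Suc n choose Suc n) = 2 * Suc n * (Suc (2 * n) choose n)"
    using Suc_times_binomial[of n "Suc (2*n)"] by (simp add: mult_ac)
  also have "(Suc (2 * n) choose n) = (Suc (2*n) choose Suc n)"
    using binomial_symmetric[of n "Suc (2*n)"] by simp
  also have "2 * Suc n * (Suc (2 * n) choose Suc n) = 2 * (Suc (2*n) * (2 * n choose n))"
    using Suc_times_binomial[of n "2*n"] by (simp only: mult.assoc)
  finally show ?thesis by (simp add: algebra_simps)
qed

text \<open>By \<open>segner_rec\<close> and \<open>central_binomial_Suc\<close>,
  \<open>Suc n * segner n\<close> and the central binomial coefficient obey the same first-order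
  recurrence and agree at 0. In particular the division in \<open>catalan\<close> is exact.\<close>

lemma catalan_eq_segner: "catalan n = segner n"
proof -
  have "Suc n * segner n = (2 * n choose n)"
  proof (induction n)
    case (Suc n)
    have "Suc n * (Suc (Suc n) * segner (Suc n)) = (4 * n + 2) * (Suc n * segner n)"
      using segner_rec[of n] by (simp add: algebra_simps del: segner.simps)
    also have "\<dots> = Suc n * (2 * Suc n choose Suc n)"
      by (simp only: Suc central_binomial_Suc)
    finally show ?case by (simp only: mult_cancel1) simp
  qed simp
  then show ?thesis
    by (metis Suc_eq_plus1 catalan_def nat.distinct(1) nonzero_mult_div_cancel_left)
qed

lemma catalan_0: "catalan 0 = 1"
  by (simp add: catalan_eq_segner)

lemma catalan_Suc: "catalan (Suc n) = (\<Sum>i\<le>n. catalan i * catalan (n - i))"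
  by (simp add: catalan_eq_segner)

section \<open>The even and odd parts of the Catalan series\<close>

lemma sum_atMost_even_split:
  fixes f :: "nat \<Rightarrow> 'a :: comm_monoid_add"
  shows "(\<Sum>i\<le>2 * m. f i) = (\<Sum>i\<le>m. f (2 * i)) + (\<Sum>i<m. f (2 * i + 1))"
  by (induction m) (simp_all add: add_ac)

lemma sum_atMost_odd_split:
  fixes f :: "nat \<Rightarrow> 'a :: comm_monoid_add"
  shows "(\<Sum>i\<le>2 * m + 1. f i) = (\<Sum>i\<le>m. f (2 * i)) + (\<Sum>i\<le>m. f (2 * i + 1))"
  by (induction m) (simp_all add: add_ac)

definition catalan_even :: "int fps" where
  "catalan_even = Abs_fps (\<lambda>n. int (catalan (2 * n)))"

definition catalan_odd :: "int fps" where
  "catalan_odd = Abs_fps (\<lambda>n. int (catalan (2 * n + 1)))"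

text \<open>Here and below E and O stand for \<open>catalan_even\<close> and
  \<open>catalan_odd\<close>. In Segner's sum for an even index the two factors have indices of
  opposite parity; the two cases are mirror images, hence the factor 2.\<close>

lemma catalan_even_eq: "catalan_even = 1 + 2 * fps_X * catalan_even * catalan_odd"
proof (rule fps_ext)
  fix n show "fps_nth catalan_even n = fps_nth (1 + 2 * fps_X * catalan_even * catalan_odd) n"
  proof (cases n)
    case 0 then show ?thesis by (simp add: catalan_even_def catalan_0 mult.assoc fps_nth_numeral_mult)
  next
    case (Suc m)
    have "int (catalan (2 * Suc m)) = (\<Sum>i\<le>2 * m + 1. int (catalan i * catalan (2 * m + 1 - i)))"
      using catalan_Suc[of "2 * m + 1"] by simp
    also have "\<dots> = (\<Sum>i\<le>m. int (catalan (2 * i) * catalan (2 * (m - i) + 1)))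
        + (\<Sum>i\<le>m. int (catalan (2 * i + 1) * catalan (2 * (m - i))))"
      unfolding sum_atMost_odd_split
      by (intro arg_cong2[where f = "(+)"] sum.cong refl)
        (simp_all add: algebra_simps Suc_diff_le diff_mult_distrib2)
    also have "(\<Sum>i\<le>m. int (catalan (2 * i + 1) * catalan (2 * (m - i))))
        = (\<Sum>i\<le>m. int (catalan (2 * i) * catalan (2 * (m - i) + 1)))"
      by (rule sum.reindex_bij_witness[where i = "\<lambda>i. m - i" and j = "\<lambda>i. m - i"]) auto
    finally show ?thesis
      using Suc by (simp add: mult.assoc fps_nth_numeral_mult fps_mult_nth[of catalan_even])
        (simp add: catalan_even_def catalan_odd_def atLeast0AtMost)
  qed
qed

text \<open>For an odd index both factors have even indices or both have odd ones. Two odd indices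
  contribute an extra 2 to the index sum, which is the factor \<open>fps_X\<close>.\<close>

lemma catalan_odd_eq: "catalan_odd = catalan_even * catalan_even + fps_X * catalan_odd * catalan_odd"
proof (rule fps_ext)
  fix m
  have "int (catalan (2 * m + 1)) = (\<Sum>i\<le>2 * m. int (catalan i * catalan (2 * m - i)))"
    using catalan_Suc[of "2 * m"] by simp
  also have "\<dots> = (\<Sum>i\<le>m. int (catalan (2 * i) * catalan (2 * (m - i))))
      + (\<Sum>i<m. int (catalan (2 * i + 1) * catalan (2 * (m - 1 - i) + 1)))"
    unfolding sum_atMost_even_split
  proof (intro arg_cong2[where f = "(+)"] sum.cong refl)
    fix i assume "i \<in> {..<m}"
    then have "2 * m - (2 * i + 1) = 2 * (m - 1 - i) + 1" by auto
    then show "int (catalan (2 * i + 1) * catalan (2 * m - (2 * i + 1)))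
        = int (catalan (2 * i + 1) * catalan (2 * (m - 1 - i) + 1))" by simp
  qed (simp add: diff_mult_distrib2)
  moreover have "fps_nth (fps_X * (catalan_odd * catalan_odd)) m
      = (\<Sum>i<m. int (catalan (2 * i + 1) * catalan (2 * (m - 1 - i) + 1)))"
    by (cases m) (simp_all add: fps_mult_nth[of catalan_odd] del: sum.atMost_Suc sum.lessThan_Suc,
      simp_all add: catalan_odd_def atLeast0AtMost lessThan_Suc_atMost)
  moreover have "fps_nth (catalan_even * catalan_even) m
      = (\<Sum>i\<le>m. int (catalan (2 * i) * catalan (2 * (m - i))))"
    by (simp add: fps_mult_nth catalan_even_def atLeast0AtMost)
  ultimately show "fps_nth catalan_odd m
      = fps_nth (catalan_even * catalan_even + fps_X * catalan_odd * catalan_odd) m"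
    by (simp add: mult.assoc) (simp add: catalan_odd_def)
qed

text \<open>Eliminates x from the two equations: multiply O by 1 = E - 2xEO, then replace xO^2 by O
  - E^2.\<close>

lemma catalan_odd_even: "catalan_odd * (1 + catalan_even) = 2 * catalan_even ^ 3"
proof -
  have "catalan_odd = catalan_odd * (catalan_even - 2 * fps_X * catalan_even * catalan_odd)"
  proof -
    have "catalan_even - 2 * fps_X * catalan_even * catalan_odd = 1"
      using catalan_even_eq by (simp add: algebra_simps)
    then show ?thesis by simp
  qed
  also have "\<dots> = catalan_odd * catalan_even - 2 * catalan_even * (fps_X * catalan_odd * catalan_odd)"
    by (simp add: algebra_simps)
  also have "fps_X * catalan_odd * catalan_odd = catalan_odd - catalan_even * catalan_even"
    using catalan_odd_eq by (simp add: algebra_simps)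
  finally show ?thesis by (simp add: algebra_simps power3_eq_cube)
qed

text \<open>This is the equation satisfied by C(4x). By \<open>catalan_odd_even\<close>, 4xE^4 =
  2xEO(1 + E) = (E - 1)(E + 1).\<close>

lemma catalan_even_square_eq: "catalan_even\<^sup>2 = 1 + 4 * fps_X * (catalan_even\<^sup>2)\<^sup>2"
proof -
  have "4 * fps_X * (catalan_even\<^sup>2)\<^sup>2 = 2 * fps_X * catalan_even * (2 * catalan_even ^ 3)"
    by (simp add: power2_eq_square power3_eq_cube algebra_simps)
  also have "\<dots> = 2 * fps_X * catalan_even * catalan_odd * (1 + catalan_even)"
    by (simp only: catalan_odd_even[symmetric] mult.assoc)
  also have "2 * fps_X * catalan_even * catalan_odd = catalan_even - 1"
    using catalan_even_eq by (simp add: algebra_simps)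
  finally show ?thesis by (simp add: power2_eq_square algebra_simps)
qed

text \<open>The preceding equation determines each coefficient from the earlier ones, and Segner's
  recurrence scaled by powers of 4 solves it.\<close>

lemma catalan_even_square_nth: "fps_nth (catalan_even\<^sup>2) n = 4 ^ n * int (catalan n)"
proof (induction n rule: less_induct)
  case (less n)
  show ?case
  proof (cases n)
    case 0
    then show ?thesis
      by (subst catalan_even_square_eq) (simp add: catalan_0 mult.assoc fps_nth_numeral_mult)
  next
    case (Suc m)
    have "fps_nth (catalan_even\<^sup>2) n = 4 * fps_nth ((catalan_even\<^sup>2) * (catalan_even\<^sup>2)) m"
      by (subst catalan_even_square_eq) (simp add: Suc mult.assoc power2_eq_square[of "catalan_even\<^sup>2"] fps_nth_numeral_mult)
    also have "\<dots> = 4 * (\<Sum>i\<le>m. 4 ^ m * int (catalan i * catalan (m - i)))"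
      unfolding fps_mult_nth atLeast0AtMost
    proof (intro arg_cong[where f = "(*) 4"] sum.cong refl)
      fix i assume "i \<in> {..m}"
      then have "i < n" "m - i < n" "(4 :: int) ^ i * 4 ^ (m - i) = 4 ^ m"
        using Suc by (simp_all add: power_add[symmetric])
      then show "fps_nth (catalan_even\<^sup>2) i * fps_nth (catalan_even\<^sup>2) (m - i)
          = 4 ^ m * int (catalan i * catalan (m - i))"
        by (simp add: less)
    qed
    finally show ?thesis
      by (simp add: Suc catalan_Suc sum_distrib_left mult.assoc)
  qed
qed

text \<open>A coefficient of E - 1 = 2xEO, in the shape of the recurrence that
  \<open>card_avoiding\<close> meets for odd \<open>d\<close>.\<close>

lemma catalan_odd_conv_even:
  "(\<Sum>i\<le>m. 2 * int (catalan (2 * (m - i) + 1)) * int (catalan (2 * i))) = int (catalan (2 * m + 2))"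
proof -
  have "fps_nth catalan_even (Suc m) = fps_nth (1 + 2 * fps_X * catalan_even * catalan_odd) (Suc m)"
    using catalan_even_eq by simp
  then show ?thesis
    by (simp add: mult.assoc fps_nth_numeral_mult fps_mult_nth[of catalan_even])
      (simp add: catalan_even_def catalan_odd_def atLeast0AtMost sum_distrib_left mult_ac)
qed

text \<open>These are the coefficients of O / E and the right-hand side of (iii) with n = m + 1.
  Integer values keep the subtraction from being truncated.\<close>

definition avoid_odd :: "nat \<Rightarrow> int" where
  "avoid_odd m = 2 * 4 ^ m * int (catalan m) - int (catalan (2 * m + 1))"

lemma Abs_avoid_odd: "Abs_fps avoid_odd = 2 * catalan_even\<^sup>2 - catalan_odd"
  by (rule fps_ext) (simp add: avoid_odd_def catalan_odd_def fps_nth_numeral_mult catalan_even_square_nth)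

text \<open>(2E^2 - O)E = O is a rearrangement of \<open>catalan_odd_even\<close>.\<close>

lemma avoid_odd_conv_even:
  "(\<Sum>i\<le>m. avoid_odd (m - i) * int (catalan (2 * i))) = int (catalan (2 * m + 1))"
proof -
  have "Abs_fps avoid_odd * catalan_even = catalan_odd"
    using catalan_odd_even by (simp add: Abs_avoid_odd power2_eq_square power3_eq_cube algebra_simps)
  then have "fps_nth (Abs_fps avoid_odd * catalan_even) m = fps_nth catalan_odd m" by simp
  then show ?thesis
    by (simp add: fps_mult_nth catalan_even_def catalan_odd_def atLeast0AtMost)
      (simp add: sum_atMost_rev[of "\<lambda>i j. avoid_odd i * int (catalan (2 * j))"])
qed

text \<open>The convolution needed for (ii). Multiplying (2E^2 - O)O by x makes both 2xEO and xO^2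
  replaceable, leaving 2E^2 - E - O, whose coefficients are known.\<close>

lemma avoid_odd_conv_odd:
  "(\<Sum>i\<le>m. avoid_odd (m - i) * int (catalan (2 * i + 1)))
    = 2 * 4 ^ Suc m * int (catalan (Suc m)) - int (catalan (2 * m + 2)) - int (catalan (2 * m + 3))"
proof -
  have "fps_X * (Abs_fps avoid_odd * catalan_odd)
      = catalan_even * (2 * fps_X * catalan_even * catalan_odd) - fps_X * catalan_odd * catalan_odd"
    by (simp add: Abs_avoid_odd power2_eq_square algebra_simps)
  also have "2 * fps_X * catalan_even * catalan_odd = catalan_even - 1"
    using catalan_even_eq by (simp add: algebra_simps)
  also have "fps_X * catalan_odd * catalan_odd = catalan_odd - catalan_even * catalan_even"
    using catalan_odd_eq by (simp add: algebra_simps)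
  finally have "fps_X * (Abs_fps avoid_odd * catalan_odd) = 2 * catalan_even\<^sup>2 - catalan_even - catalan_odd"
    by (simp add: power2_eq_square algebra_simps)
  then have "fps_nth (fps_X * (Abs_fps avoid_odd * catalan_odd)) (Suc m)
      = fps_nth (2 * catalan_even\<^sup>2 - catalan_even - catalan_odd) (Suc m)" by simp
  then show ?thesis
    by (simp add: fps_mult_nth[of "Abs_fps avoid_odd"] atLeast0AtMost fps_nth_numeral_mult catalan_even_square_nth)
      (simp add: catalan_even_def catalan_odd_def numeral_3_eq_3
        sum_atMost_rev[of "\<lambda>i j. avoid_odd i * int (catalan (Suc (2 * j)))"])
qed

subsection \<open>Triangulations\<close>

definition chords :: "nat set \<Rightarrow> (nat \<times> nat) set" where
  "chords V = {(a, b). a \<in> V \<and> b \<in> V \<and> a < b}"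

text \<open>One fixed-point equation encodes non-crossing (left to right) and maximality (right to
  left). Sides cross nothing, so every member contains all of them.\<close>

definition triangulations :: "nat set \<Rightarrow> (nat \<times> nat) set set" where
  "triangulations V = {T. T = {d \<in> chords V. \<forall>e\<in>T. \<not> crosses d e}}"

lemma triangulationsI:
  assumes "T \<subseteq> chords V" "\<And>d e. d \<in> T \<Longrightarrow> e \<in> T \<Longrightarrow> \<not> crosses d e"
    "\<And>d. d \<in> chords V \<Longrightarrow> (\<And>e. e \<in> T \<Longrightarrow> \<not> crosses d e) \<Longrightarrow> d \<in> T"
  shows "T \<in> triangulations V"
  using assms unfolding triangulations_def by blast

lemma triangulations_subset: "T \<in> triangulations V \<Longrightarrow> T \<subseteq> chords V"
  unfolding triangulations_def by blast

lemma triangulations_noncrossing: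
  "T \<in> triangulations V \<Longrightarrow> d \<in> T \<Longrightarrow> e \<in> T \<Longrightarrow> \<not> crosses d e"
  unfolding triangulations_def by blast

lemma triangulations_maximal:
  assumes "T \<in> triangulations V" "d \<in> chords V" "\<And>e. e \<in> T \<Longrightarrow> \<not> crosses d e"
  shows "d \<in> T"
  using assms unfolding triangulations_def by blast

lemma mem_chords [simp]: "(a, b) \<in> chords V \<longleftrightarrow> a \<in> V \<and> b \<in> V \<and> a < b"
  by (simp add: chords_def)

lemma crosses_pair [simp]:
  "crosses (a, b) (c, d) \<longleftrightarrow> (a < c \<and> c < b \<and> b < d) \<or> (c < a \<and> a < d \<and> d < b)"
  by (simp add: crosses_def)

lemma finite_chords: "finite V \<Longrightarrow> finite (chords V)"
  by (rule finite_subset[of _ "V \<times> V"]) (auto simp: chords_def)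

lemma finite_triangulations: "finite V \<Longrightarrow> finite (triangulations V)"
  by (rule finite_subset[of _ "Pow (chords V)"]) (auto dest: triangulations_subset finite_chords)

text \<open>A chord not crossing \<open>(a, b)\<close> lies in one of the two pieces, and chords of
  different pieces never cross, so restriction and union are mutually inverse. Since
  \<open>(a, b)\<close> is a side of both pieces, every triangulation of either contains it.
  \<open>R\<close> and \<open>S\<close> carry independent constraints on the pieces through the
  cut.\<close>

lemma card_triangulations_split:
  assumes "a \<in> V" "b \<in> V" "a < b"
  defines "V1 \<equiv> V \<inter> {a..b}" and "V2 \<equiv> V - {a<..<b}"
  shows "card {T \<in> triangulations V. (a, b) \<in> T \<and> R (T \<inter> chords V1) \<and> S (T \<inter> chords V2)} =
    card {T \<in> triangulations V1. R T} * card {T \<in> triangulations V2. S T}"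
proof -
  let ?f = "\<lambda>T. (T \<inter> chords V1, T \<inter> chords V2)"
  let ?g = "\<lambda>(T1, T2). T1 \<union> T2"
  let ?A = "{T \<in> triangulations V. (a, b) \<in> T \<and> R (T \<inter> chords V1) \<and> S (T \<inter> chords V2)}"
  let ?B = "{T \<in> triangulations V1. R T} \<times> {T \<in> triangulations V2. S T}"
  have cover: "d \<in> chords V1 \<union> chords V2" if "d \<in> chords V" "\<not> crosses d (a, b)" for d
    using that by (cases d) (auto simp: V1_def V2_def)
  have indep: "\<not> crosses d e" "\<not> crosses e d" if "d \<in> chords V1" "e \<in> chords V2" for d e
    using that by (cases d; cases e; auto simp: V1_def V2_def)+
  have meet: "chords V1 \<inter> chords V2 = {(a, b)}"
    using assms by (auto simp: chords_def)
  have sub: "chords V1 \<subseteq> chords V" "chords V2 \<subseteq> chords V"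
    by (auto simp: chords_def V1_def V2_def)
  have ab: "(a, b) \<in> chords V1" "(a, b) \<in> chords V2"
    using meet by blast+
  have side: "(a, b) \<in> T" if "T \<in> triangulations V1 \<or> T \<in> triangulations V2" for T
    using that
  proof
    assume T: "T \<in> triangulations V1"
    show ?thesis
      by (rule triangulations_maximal[OF T ab(1)]) (use triangulations_subset[OF T] indep ab in blast)
  next
    assume T: "T \<in> triangulations V2"
    show ?thesis
      by (rule triangulations_maximal[OF T ab(2)]) (use triangulations_subset[OF T] indep ab in blast)
  qed
  have decomp: "T = T \<inter> chords V1 \<union> T \<inter> chords V2" if "T \<in> triangulations V" "(a, b) \<in> T" for T
    using that cover triangulations_subset triangulations_noncrossing by blast
  have f1: "T \<inter> chords V1 \<in> triangulations V1" if T: "T \<in> triangulations V" "(a, b) \<in> T" for T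
  proof (rule triangulationsI)
    fix d assume d: "d \<in> chords V1" "\<And>e. e \<in> T \<inter> chords V1 \<Longrightarrow> \<not> crosses d e"
    have "\<not> crosses d e" if "e \<in> T" for e
      using that d decomp[OF T] indep(1)[of d e] by blast
    then show "d \<in> T \<inter> chords V1"
      using d T sub triangulations_maximal by blast
  qed (use T triangulations_noncrossing in auto)
  have f2: "T \<inter> chords V2 \<in> triangulations V2" if T: "T \<in> triangulations V" "(a, b) \<in> T" for T
  proof (rule triangulationsI)
    fix d assume d: "d \<in> chords V2" "\<And>e. e \<in> T \<inter> chords V2 \<Longrightarrow> \<not> crosses d e"
    have "\<not> crosses d e" if "e \<in> T" for e
      using that d decomp[OF T] indep(2)[of e d] by blast
    then show "d \<in> T \<inter> chords V2"
      using d T sub triangulations_maximal by blast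
  qed (use T triangulations_noncrossing in auto)
  have g: "T1 \<union> T2 \<in> triangulations V"
    if T: "T1 \<in> triangulations V1" "T2 \<in> triangulations V2" for T1 T2
  proof (rule triangulationsI)
    show "T1 \<union> T2 \<subseteq> chords V"
      using T sub triangulations_subset by blast
  next
    fix d e assume "d \<in> T1 \<union> T2" "e \<in> T1 \<union> T2"
    then show "\<not> crosses d e"
      using indep triangulations_noncrossing T triangulations_subset[OF T(1)] triangulations_subset[OF T(2)]
      by blast
  next
    fix d assume d: "d \<in> chords V" "\<And>e. e \<in> T1 \<union> T2 \<Longrightarrow> \<not> crosses d e"
    have "\<not> crosses d (a, b)"
      using d(2) side T by blast
    then show "d \<in> T1 \<union> T2"
      using cover[OF d(1)] d(2) triangulations_maximal[OF T(1), of d] triangulations_maximal[OF T(2), of d]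
      by blast
  qed
  have gf: "(T1 \<union> T2) \<inter> chords V1 = T1" "(T1 \<union> T2) \<inter> chords V2 = T2"
    if T: "T1 \<in> triangulations V1" "T2 \<in> triangulations V2" for T1 T2
  proof -
    have eq: "d = (a, b)" if "d \<in> chords V1" "d \<in> chords V2" for d
      using that meet by blast
    have sub: "T1 \<subseteq> chords V1" "T2 \<subseteq> chords V2"
      using T triangulations_subset by blast+
    have side: "(a, b) \<in> T1" "(a, b) \<in> T2"
      using T side by blast+
    show "(T1 \<union> T2) \<inter> chords V1 = T1" "(T1 \<union> T2) \<inter> chords V2 = T2"
      using eq subsetD[OF sub(1)] subsetD[OF sub(2)] side by (blast, blast)
  qed
  have "bij_betw ?f ?A ?B"
  proof (rule bij_betw_byWitness[where f' = ?g])
    show "\<forall>T\<in>?A. ?g (?f T) = T"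
      unfolding prod.case using decomp[symmetric] by blast
    show "\<forall>p\<in>?B. ?f (?g p) = p"
      using gf by (simp add: Ball_def)
    show "?f ` ?A \<subseteq> ?B"
      using f1 f2 by (simp add: image_subset_iff)
    show "?g ` ?B \<subseteq> ?A"
      using g gf side by (simp add: image_subset_iff)
  qed
  then show ?thesis
    by (simp add: bij_betw_same_card card_cartesian_product)
qed

section \<open>Triangulations are counted by Catalan numbers\<close>

lemma triangulations_no_crossing:
  assumes "\<And>d e. d \<in> chords V \<Longrightarrow> e \<in> chords V \<Longrightarrow> \<not> crosses d e"
  shows "triangulations V = {chords V}"
  using assms unfolding triangulations_def by blast

text \<open>Turns a sum over apexes into a sum over the number of vertices before the apex, the
  index in Segner's recurrence.\<close>

lemma bij_betw_rank:
  fixes M :: "'a :: linorder set"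
  assumes "finite M"
  shows "bij_betw (\<lambda>c. card (M \<inter> {..<c})) M {..<card M}"
proof -
  have less: "card (M \<inter> {..<c}) < card (M \<inter> {..<c'})" if "c \<in> M" "c < c'" for c c'
    using that assms by (intro psubset_card_mono) auto
  have "inj_on (\<lambda>c. card (M \<inter> {..<c})) M"
    by (rule linorder_inj_onI') (use less in \<open>metis less_irrefl\<close>)
  moreover have "card (M \<inter> {..<c}) < card M" if "c \<in> M" for c
    using that assms by (intro psubset_card_mono) auto
  then have "(\<lambda>c. card (M \<inter> {..<c})) ` M \<subseteq> {..<card M}" by auto
  ultimately show ?thesis
    unfolding bij_betw_def by (simp add: card_subset_eq card_image)
qed

text \<open>Every triangulation has exactly one triangle at the side joining the extreme vertices;
  its apex is the last neighbour of the least vertex before the greatest one.\<close>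

lemma triangulation_apex:
  assumes T: "T \<in> triangulations V" and V: "finite V" "a \<in> V" "b \<in> V" "V \<subseteq> {a..b}"
    and M: "V \<inter> {a<..<b} \<noteq> {}"
  shows "\<exists>!c. c \<in> V \<inter> {a<..<b} \<and> (a, c) \<in> T \<and> (c, b) \<in> T"
proof -
  let ?N = "{c \<in> V \<inter> {a<..<b}. (a, c) \<in> T}"
  define m where "m = Min (V \<inter> {a<..<b})"
  have m: "m \<in> V \<inter> {a<..<b}" and m_le: "\<And>c. c \<in> V \<inter> {a<..<b} \<Longrightarrow> m \<le> c"
    using M V(1) Min_in[of "V \<inter> {a<..<b}"] by (auto simp: m_def)
  \<comment> \<open>\<open>(a, m)\<close> is a side because \<open>m\<close> follows
    \<open>a\<close> immediately; so the candidates for the apex form a nonempty set.\<close>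
  have "(a, m) \<in> T"
  proof (rule triangulations_maximal[OF T])
    show "(a, m) \<in> chords V" using m V by simp
    fix e assume "e \<in> T"
    then obtain x y where e: "e = (x, y)" "x \<in> V" "y \<in> V" "x < y"
      using triangulations_subset[OF T] by (cases e) auto
    then have "a \<le> x" "y \<le> b" using V(4) by auto
    then have "\<not> (a < x \<and> x < m)" using m_le[of x] e m by auto
    then show "\<not> crosses (a, m) e" using e \<open>a \<le> x\<close> by auto
  qed
  then have N: "finite ?N" "?N \<noteq> {}" using m V(1) by auto
  define c where "c = Max ?N"
  have c: "c \<in> V" "a < c" "c < b" "(a, c) \<in> T" and c_ge: "\<And>y. y \<in> ?N \<Longrightarrow> y \<le> c"
    using Max_in[OF N] Max_ge[OF N(1)] by (auto simp: c_def)
  \<comment> \<open>A chord of \<open>T\<close> crossing \<open>(c, b)\<close> would have to start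
    before \<open>c\<close> and end strictly between \<open>c\<close> and \<open>b\<close>. Starting
    at \<open>a\<close> contradicts the maximality of \<open>c\<close>; starting later makes it
    cross \<open>(a, c)\<close>.\<close>
  have "(c, b) \<in> T"
  proof (rule triangulations_maximal[OF T])
    show "(c, b) \<in> chords V" using c V by simp
    fix e assume "e \<in> T"
    then obtain x y where e: "e = (x, y)" "x \<in> V" "y \<in> V" "x < y"
      using triangulations_subset[OF T] by (cases e) auto
    then have xy: "a \<le> x" "y \<le> b" using V(4) by auto
    have "\<not> crosses (a, c) e" using \<open>e \<in> T\<close> c T triangulations_noncrossing by blast
    moreover have "\<not> (x = a \<and> c < y \<and> y < b)"
      using c_ge[of y] e \<open>e \<in> T\<close> by auto
    ultimately show "\<not> crosses (c, b) e" using e xy c by auto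
  qed
  moreover have "c1 = c2" if "(a, c1) \<in> T" "(c1, b) \<in> T" "(a, c2) \<in> T" "(c2, b) \<in> T"
    "c1 \<in> {a<..<b}" "c2 \<in> {a<..<b}" for c1 c2
  proof -
    have "\<not> crosses (a, c2) (c1, b)" "\<not> crosses (a, c1) (c2, b)"
      using that T triangulations_noncrossing by blast+
    then show ?thesis using that by auto
  qed
  ultimately show ?thesis using c by (intro ex1I[of _ c]) auto
qed

text \<open>Arbitrary finite vertex sets are needed because cutting leaves gaps in the labels. The
  case n = 0 is a polygon with two vertices and a single chord.\<close>

theorem card_triangulations:
  "finite V \<Longrightarrow> card V = n + 2 \<Longrightarrow> card (triangulations V) = catalan n"
proof (induction n arbitrary: V rule: less_induct)
  case (less n)
  define a b where "a = Min V" and "b = Max V"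
  have "V \<noteq> {}" using less.prems by auto
  then have ab: "a \<in> V" "b \<in> V" "V \<subseteq> {a..b}"
    using less.prems by (auto simp: a_def b_def)
  have "a \<noteq> b"
  proof
    assume "a = b"
    then have "V \<subseteq> {a}" using ab by auto
    then show False using less.prems card_mono[of "{a}" V] by simp
  qed
  then have "a < b" using ab by force
  let ?M = "V \<inter> {a<..<b}"
  let ?r = "\<lambda>c. card (?M \<inter> {..<c})"
  have V: "V = insert a (insert b ?M)" using ab \<open>a < b\<close> by auto
  have cardM: "card ?M = n"
  proof -
    have "card V = Suc (Suc (card ?M))"
      using less.prems(1) \<open>a < b\<close> by (subst V) (simp add: card_insert_if)
    then show ?thesis using less.prems by simp
  qed
  show ?case
  proof (cases n)
    case 0
    then have "?M = {}" using cardM less.prems(1) by simp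
    then have "V = {a, b}" using V by simp
    then have "triangulations V = {chords V}"
      by (intro triangulations_no_crossing) auto
    then show ?thesis using 0 by (simp add: catalan_0)
  next
    case (Suc m)
    have M: "?M \<noteq> {}" using cardM Suc by auto
    let ?A = "\<lambda>c. {T \<in> triangulations V. (a, c) \<in> T \<and> (c, b) \<in> T}"
    \<comment> \<open>Two cuts, along \<open>(a, c)\<close> and then along \<open>(c, b)\<close>,
      leave the polygons before and after \<open>c\<close> and the triangle
      \<open>{a, c, b}\<close>, which has one triangulation.\<close>
    have summand: "card (?A c) = catalan (?r c) * catalan (m - ?r c)" if c: "c \<in> ?M" for c
    proof -
      let ?V2 = "V - {a<..<c}"
      have 1: "card (?A c) = card (triangulations (V \<inter> {a..c})) * card {T \<in> triangulations ?V2. (c, b) \<in> T}"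
        using card_triangulations_split[of a V c "\<lambda>_. True" "\<lambda>T. (c, b) \<in> T"] c ab by simp
      have 2: "?V2 \<inter> {c..b} = V \<inter> {c..b}" "?V2 - {c<..<b} = {a, c, b}"
        using c ab by auto
      have "card {T \<in> triangulations ?V2. (c, b) \<in> T}
          = card (triangulations (V \<inter> {c..b})) * card (triangulations {a, c, b})"
        using card_triangulations_split[of c ?V2 b "\<lambda>_. True" "\<lambda>_. True"] c ab by (simp add: 2)
      moreover have "triangulations {a, c, b} = {chords {a, c, b}}"
        using c by (intro triangulations_no_crossing) auto
      ultimately have 3: "card (?A c) = card (triangulations (V \<inter> {a..c})) * card (triangulations (V \<inter> {c..b}))"
        using 1 by simp
      have r: "?r c < n"
        using bij_betw_rank[of ?M] c less.prems(1) cardM by (auto simp: bij_betw_def)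
      have "V \<inter> {a..c} = insert a (insert c (?M \<inter> {..<c}))" using c ab by auto
      then have "card (V \<inter> {a..c}) = ?r c + 2"
        using c less.prems(1) by (simp add: card_insert_if)
      moreover have "card (V \<inter> {c..b}) = (m - ?r c) + 2"
      proof -
        have "V = insert a (?M \<inter> {..<c} \<union> V \<inter> {c..b})" using c ab by auto
        moreover have "card (insert a (?M \<inter> {..<c} \<union> V \<inter> {c..b})) = Suc (?r c + card (V \<inter> {c..b}))"
          using c less.prems(1) by (subst card_insert_disjoint) (auto intro!: card_Un_disjoint)
        ultimately show ?thesis using less.prems(2) r Suc by simp
      qed
      ultimately show ?thesis
        using 3 less.IH[of "?r c" "V \<inter> {a..c}"] less.IH[of "m - ?r c" "V \<inter> {c..b}"] r Suc less.prems(1)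
        by simp
    qed
    have "triangulations V = (\<Union>c\<in>?M. ?A c)"
      using triangulation_apex[OF _ less.prems(1) ab M] by blast
    also have "card \<dots> = (\<Sum>c\<in>?M. card (?A c))"
    proof (rule card_UN_disjoint)
      show "\<forall>c\<in>?M. \<forall>c'\<in>?M. c \<noteq> c' \<longrightarrow> ?A c \<inter> ?A c' = {}"
        using triangulation_apex[OF _ less.prems(1) ab M] by blast
    qed (use less.prems(1) finite_triangulations in auto)
    also have "\<dots> = (\<Sum>c\<in>?M. catalan (?r c) * catalan (m - ?r c))"
      using summand by (intro sum.cong) auto
    also have "\<dots> = (\<Sum>i<card ?M. catalan i * catalan (m - i))"
      using less.prems(1) by (intro sum.reindex_bij_betw bij_betw_rank) simp
    finally show ?thesis
      by (simp add: cardM Suc catalan_Suc lessThan_Suc_atMost)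
  qed
qed

section \<open>Avoiding a nested family of parallel chords\<close>

text \<open>Elements are sorted by the largest index whose property holds; for nested chords this is
  the innermost chord present.\<close>

lemma card_partition_last:
  fixes P :: "nat \<Rightarrow> 'a \<Rightarrow> bool"
  shows "finite A \<Longrightarrow> card A = card {t \<in> A. \<forall>i<k. \<not> P i t}
    + (\<Sum>i<k. card {t \<in> A. P i t \<and> (\<forall>j. i < j \<and> j < k \<longrightarrow> \<not> P j t)})"
proof (induction k arbitrary: A)
  case (Suc k)
  let ?A = "{t \<in> A. \<not> P k t}"
  have "card A = card ?A + card {t \<in> A. P k t}"
    using Suc.prems by (subst card_Un_disjoint[symmetric]) (auto intro: arg_cong[where f = card])
  also have "card ?A = card {t \<in> ?A. \<forall>i<k. \<not> P i t}
    + (\<Sum>i<k. card {t \<in> ?A. P i t \<and> (\<forall>j. i < j \<and> j < k \<longrightarrow> \<not> P j t)})"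
    using Suc.prems by (intro Suc.IH) simp
  also have "{t \<in> ?A. \<forall>i<k. \<not> P i t} = {t \<in> A. \<forall>i<Suc k. \<not> P i t}"
    by (auto simp: less_Suc_eq)
  also have "(\<Sum>i<k. card {t \<in> ?A. P i t \<and> (\<forall>j. i < j \<and> j < k \<longrightarrow> \<not> P j t)})
    = (\<Sum>i<k. card {t \<in> A. P i t \<and> (\<forall>j. i < j \<and> j < Suc k \<longrightarrow> \<not> P j t)})"
    by (intro sum.cong refl arg_cong[where f = card]) (auto simp: less_Suc_eq)
  also have "{t \<in> A. P k t} = {t \<in> A. P k t \<and> (\<forall>j. k < j \<and> j < Suc k \<longrightarrow> \<not> P j t)}"
    by auto
  finally show ?case by simp
qed simp

text \<open>The chords \<open>(x + j, x + d - j)\<close> with \<open>2 j + 2 \<le> d\<close> are nested and parallel; the bound on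
  \<open>j\<close> leaves out a possible innermost one of length 1, which is a side.\<close>

definition avoiding :: "nat set \<Rightarrow> nat \<Rightarrow> nat \<Rightarrow> (nat \<times> nat) set set" where
  "avoiding V x d = {T \<in> triangulations V. \<forall>j<d div 2. (x + j, x + d - j) \<notin> T}"

text \<open>Cut along the innermost chord present. Inside it all further chords of the family are
  avoided; the outer polygon loses \<open>d - 2 * i - 1\<close> vertices and is
  unrestricted.\<close>

lemma catalan_eq_sum_avoiding:
  assumes V: "finite V" "{x..x + d} \<subseteq> V" "card V = c + 2"
  shows "catalan c = card (avoiding V x d) + (\<Sum>i<d div 2.
    card (avoiding {x + i..x + d - i} (x + i + 1) (d - 2 * i - 2)) * catalan (c - (d - 2 * i - 1)))"
proof -
  let ?P = "\<lambda>i T. (x + i, x + d - i) \<in> T"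
  have "card {T \<in> triangulations V. ?P i T \<and> (\<forall>j. i < j \<and> j < d div 2 \<longrightarrow> \<not> ?P j T)}
    = card (avoiding {x + i..x + d - i} (x + i + 1) (d - 2 * i - 2)) * catalan (c - (d - 2 * i - 1))"
    if "i < d div 2" for i
  proof -
    let ?a = "x + i" and ?b = "x + d - i"
    let ?R = "\<lambda>T. \<forall>j<(d - 2 * i - 2) div 2. (x + i + 1 + j, x + i + 1 + (d - 2 * i - 2) - j) \<notin> T"
    have i: "2 * i + 2 \<le> d" using that by auto
    have sub: "{?a..?b} \<subseteq> V" using V(2) by (rule order_trans[rotated]) auto
    have ab: "?a \<in> V" "?b \<in> V" "?a < ?b" using sub i by auto
    have V1: "V \<inter> {?a..?b} = {?a..?b}" using sub by blast
    have "{?a<..<?b} \<subseteq> V" using sub by (rule order_trans[rotated]) auto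
    then have "card (V - {?a<..<?b}) = card V - card {?a<..<?b}" "card {?a<..<?b} \<le> card V"
      using V(1) by (simp_all only: card_Diff_subset card_mono finite_greaterThanLessThan)
    moreover have "card {x..x + d} \<le> card V" using V by (intro card_mono)
    ultimately have V2: "card (V - {?a<..<?b}) = (c - (d - 2 * i - 1)) + 2"
      using V(3) i by simp
    \<comment> \<open>The chords with index beyond \<open>i\<close> lie in the inner polygon and
      form its own nested family after shifting the index by \<open>i + 1\<close>.\<close>
    have R: "(\<forall>j. i < j \<and> j < d div 2 \<longrightarrow> \<not> ?P j T) \<longleftrightarrow> ?R (T \<inter> chords {?a..?b})" for T
    proof
      assume L: "\<forall>j. i < j \<and> j < d div 2 \<longrightarrow> \<not> ?P j T"
      show "?R (T \<inter> chords {?a..?b})"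
      proof (intro allI impI)
        fix j assume "j < (d - 2 * i - 2) div 2"
        then show "(x + i + 1 + j, x + i + 1 + (d - 2 * i - 2) - j) \<notin> T \<inter> chords {?a..?b}"
          using L[rule_format, of "i + 1 + j"] i by (auto simp: algebra_simps)
      qed
    next
      assume L: "?R (T \<inter> chords {?a..?b})"
      show "\<forall>j. i < j \<and> j < d div 2 \<longrightarrow> \<not> ?P j T"
      proof (intro allI impI)
        fix j assume j: "i < j \<and> j < d div 2"
        then have "j - i - 1 < (d - 2 * i - 2) div 2" by auto
        moreover have "x + i + 1 + (j - i - 1) = x + j"
          "x + i + 1 + (d - 2 * i - 2) - (j - i - 1) = x + d - j" using j i by auto
        ultimately have "(x + j, x + d - j) \<notin> T \<inter> chords {?a..?b}"
          using L by metis
        moreover have "(x + j, x + d - j) \<in> chords {?a..?b}" using j by auto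
        ultimately show "\<not> ?P j T" by blast
      qed
    qed
    have "card {T \<in> triangulations V. ?P i T \<and> (\<forall>j. i < j \<and> j < d div 2 \<longrightarrow> \<not> ?P j T)}
      = card {T \<in> triangulations {?a..?b}. ?R T} * card (triangulations (V - {?a<..<?b}))"
      using card_triangulations_split[OF ab, of ?R "\<lambda>_. True"] unfolding R V1
      by (simp only: simp_thms Collect_mem_eq)
    then show ?thesis
      using V2 V(1) by (simp only: avoiding_def card_triangulations finite_Diff)
  qed
  then show ?thesis
    using card_partition_last[of "triangulations V" "d div 2" ?P] V
    by (simp add: avoiding_def card_triangulations finite_triangulations)
qed

text \<open>With exactly two vertices outside \<open>{x..x + d}\<close>, the inner polygons are of
  the same type with smaller \<open>d\<close> of the same parity, so the recurrence closes. The
  outer factors are Catalan numbers of even index.\<close>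

lemma card_avoiding:
  "finite V \<Longrightarrow> {x..x + d} \<subseteq> V \<Longrightarrow> card V = d + 3 \<Longrightarrow>
    int (card (avoiding V x d)) = (if even d then avoid_odd (d div 2) else 2 * int (catalan d))"
proof (induction d arbitrary: V x rule: less_induct)
  case (less d)
  let ?W = "\<lambda>d. if even d then avoid_odd (d div 2) else 2 * int (catalan d)"
  have "int (catalan (d + 1)) = int (card (avoiding V x d)) + (\<Sum>i<d div 2.
    int (card (avoiding {x + i..x + d - i} (x + i + 1) (d - 2 * i - 2)))
      * int (catalan (d + 1 - (d - 2 * i - 1))))"
    using catalan_eq_sum_avoiding[of V x d "d + 1"] less.prems by simp
  also have "(\<Sum>i<d div 2. int (card (avoiding {x + i..x + d - i} (x + i + 1) (d - 2 * i - 2)))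
      * int (catalan (d + 1 - (d - 2 * i - 1))))
    = (\<Sum>i<d div 2. ?W (d - 2 * i - 2) * int (catalan (2 * Suc i)))"
  proof (intro sum.cong refl arg_cong2[where f = "(*)"])
    fix i assume "i \<in> {..<d div 2}"
    then have i: "2 * i + 2 \<le> d" by auto
    then have "card {x + i..x + d - i} = d - 2 * i - 2 + 3" by simp
    then show "int (card (avoiding {x + i..x + d - i} (x + i + 1) (d - 2 * i - 2))) = ?W (d - 2 * i - 2)"
      using i by (intro less.IH) auto
    show "int (catalan (d + 1 - (d - 2 * i - 1))) = int (catalan (2 * Suc i))"
      using i by (intro arg_cong[where f = "\<lambda>k. int (catalan k)"]) auto
  qed
  finally have rec: "int (catalan (d + 1)) = int (card (avoiding V x d))
    + (\<Sum>i<d div 2. ?W (d - 2 * i - 2) * int (catalan (2 * Suc i)))" .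
  show ?case
  proof (cases "even d")
    case True
    then obtain m where d: "d = 2 * m" by blast
    have "(\<Sum>i<d div 2. ?W (d - 2 * i - 2) * int (catalan (2 * Suc i)))
      = (\<Sum>i<m. avoid_odd (m - Suc i) * int (catalan (2 * Suc i)))"
    proof (intro sum.cong)
      fix i
      have "d - 2 * i - 2 = 2 * (m - Suc i)" using d by auto
      then show "?W (d - 2 * i - 2) * int (catalan (2 * Suc i))
        = avoid_odd (m - Suc i) * int (catalan (2 * Suc i))" by simp
    qed (simp add: d)
    \<comment> \<open>The index-0 term of the convolution has the factor C_0 = 1 and so is the count
      sought; the other terms match the sum in \<open>rec\<close>.\<close>
    then show ?thesis
      using rec avoid_odd_conv_even[of m]
      by (simp add: d catalan_0 sum.atMost_shift del: mult_Suc_right)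
  next
    case False
    then obtain m where d: "d = 2 * m + 1" by (auto elim: oddE)
    have "(\<Sum>i<d div 2. ?W (d - 2 * i - 2) * int (catalan (2 * Suc i)))
      = (\<Sum>i<m. 2 * int (catalan (2 * (m - Suc i) + 1)) * int (catalan (2 * Suc i)))"
    proof (intro sum.cong)
      fix i assume "i \<in> {..<m}"
      then have "d - 2 * i - 2 = 2 * (m - Suc i) + 1" using d by auto
      then show "?W (d - 2 * i - 2) * int (catalan (2 * Suc i))
        = 2 * int (catalan (2 * (m - Suc i) + 1)) * int (catalan (2 * Suc i))" by simp
    qed (simp add: d)
    then show ?thesis
      using rec catalan_odd_conv_even[of m]
      by (simp add: d catalan_0 sum.atMost_shift del: mult_Suc_right)
  qed
qed

section \<open>From triangulations with sides to sets of diagonals\<close>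

lemma diagonals_subset_chords: "diagonals N \<subseteq> chords {..<N}"
  by (auto simp: diagonals_def is_diagonal_def)

lemma side_crosses_nothing:
  assumes "d \<in> chords {..<N} - diagonals N" "e \<in> chords {..<N}"
  shows "\<not> crosses d e" "\<not> crosses e d"
  using assms by (cases d; cases e; auto simp: diagonals_def is_diagonal_def)+

text \<open>Adding and removing all sides is a bijection. The avoidance condition is restricted to
  diagonals because a side, present in every \<open>T\<close>, may itself be parallel to the given
  segment.\<close>

lemma f_count_eq_card_triangulations:
  "f_count N p q
    = card {T \<in> triangulations {..<N}. \<forall>d\<in>diagonals N. parallel N d p q \<longrightarrow> d \<notin> T}"
proof -
  let ?S = "chords {..<N} - diagonals N"
  let ?A = "{T \<in> triangulations {..<N}. \<forall>d\<in>diagonals N. parallel N d p q \<longrightarrow> d \<notin> T}"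
  let ?B = "{T. triangulation N T \<and> (\<forall>d\<in>T. \<not> parallel N d p q)}"
  have sides: "?S \<subseteq> T" if T: "T \<in> triangulations {..<N}" for T
    using triangulations_maximal[OF T] triangulations_subset[OF T] side_crosses_nothing(1) by blast
  have restrict: "triangulation N (T \<inter> diagonals N)" if T: "T \<in> triangulations {..<N}" for T
  proof -
    have "\<exists>e\<in>T \<inter> diagonals N. crosses d e" if d: "d \<in> diagonals N - T \<inter> diagonals N" for d
    proof -
      have dc: "d \<in> chords {..<N}" "d \<notin> T" using d diagonals_subset_chords by auto
      then obtain e where e: "e \<in> T" "crosses d e" using triangulations_maximal[OF T] by blast
      then have "e \<in> diagonals N"
        using side_crosses_nothing(2)[of e N d] dc triangulations_subset[OF T] by blast
      then show ?thesis using e by blast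
    qed
    then show ?thesis
      unfolding triangulation_def using triangulations_noncrossing[OF T] by blast
  qed
  have extend: "U \<union> ?S \<in> triangulations {..<N}" if U: "triangulation N U" for U
  proof (rule triangulationsI)
    have U': "U \<subseteq> diagonals N" "\<And>d e. d \<in> U \<Longrightarrow> e \<in> U \<Longrightarrow> \<not> crosses d e"
      "\<And>d. d \<in> diagonals N - U \<Longrightarrow> \<exists>e\<in>U. crosses d e"
      using U unfolding triangulation_def by blast+
    show sub: "U \<union> ?S \<subseteq> chords {..<N}"
      using U'(1) diagonals_subset_chords by blast
    show "\<not> crosses d e" if "d \<in> U \<union> ?S" "e \<in> U \<union> ?S" for d e
      using that sub U'(2) side_crosses_nothing by blast
    show "d \<in> U \<union> ?S" if "d \<in> chords {..<N}" "\<And>e. e \<in> U \<union> ?S \<Longrightarrow> \<not> crosses d e" for d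
      using that U'(3) by blast
  qed
  have "bij_betw (\<lambda>T. T \<inter> diagonals N) ?A ?B"
  proof (rule bij_betw_byWitness[where f' = "\<lambda>U. U \<union> ?S"])
    show "\<forall>T\<in>?A. T \<inter> diagonals N \<union> ?S = T"
      using sides triangulations_subset by blast
    show "\<forall>U\<in>?B. (U \<union> ?S) \<inter> diagonals N = U"
      unfolding triangulation_def by blast
    show "(\<lambda>T. T \<inter> diagonals N) ` ?A \<subseteq> ?B"
      using restrict by auto
    show "(\<lambda>U. U \<union> ?S) ` ?B \<subseteq> ?A"
      using extend by auto
  qed
  then show ?thesis
    by (simp add: f_count_def bij_betw_same_card)
qed

section \<open>The parallel classes of 01 and 02\<close>

lemma mod_eq_small:
  fixes s N k :: nat
  assumes "s < 2 * N" "k < N"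
  shows "s mod N = k mod N \<longleftrightarrow> s = k \<or> s = N + k"
  using assms by (cases "s < N") (auto simp: le_mod_geq)

text \<open>A diagonal has endpoint sum below 2N, so the sum is 1 or N + 1. Sum 1 is the side 01,
  and sum N + 1 forces a start of at least 2 since the end is at most N - 1.\<close>

lemma parallel_01:
  assumes "N \<ge> 3"
  shows "d \<in> diagonals N \<and> parallel N d 0 1 \<longleftrightarrow> (\<exists>j<(N - 3) div 2. d = (2 + j, 2 + (N - 3) - j))"
    (is "?L \<longleftrightarrow> ?R")
proof -
  obtain a b where d: "d = (a, b)" by (cases d)
  have "?L \<longleftrightarrow> d \<in> diagonals N \<and> a + b = N + 1"
    using mod_eq_small[of "a + b" N 1] assms by (auto simp: d parallel_def diagonals_def is_diagonal_def)
  also have "\<dots> \<longleftrightarrow> ?R"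
  proof
    assume "d \<in> diagonals N \<and> a + b = N + 1"
    then show ?R
      by (intro exI[of _ "a - 2"]) (auto simp: d diagonals_def is_diagonal_def)
  qed (use assms in \<open>auto simp: d diagonals_def is_diagonal_def\<close>)
  finally show ?thesis .
qed

text \<open>Sum 2 now gives the genuine diagonal \<open>(0, 2)\<close>, which is not nested with the
  others; sum N + 2 gives a nested family starting at 3.\<close>

lemma parallel_02:
  assumes "N \<ge> 4"
  shows "d \<in> diagonals N \<and> parallel N d 0 2
    \<longleftrightarrow> d = (0, 2) \<or> (\<exists>j<(N - 4) div 2. d = (3 + j, 3 + (N - 4) - j))"
    (is "?L \<longleftrightarrow> _ \<or> ?R")
proof -
  obtain a b where d: "d = (a, b)" by (cases d)
  have "?L \<longleftrightarrow> d = (0, 2) \<or> d \<in> diagonals N \<and> a + b = N + 2"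
    using mod_eq_small[of "a + b" N 2] assms by (auto simp: d parallel_def diagonals_def is_diagonal_def)
  also have "d \<in> diagonals N \<and> a + b = N + 2 \<longleftrightarrow> ?R"
  proof
    assume "d \<in> diagonals N \<and> a + b = N + 2"
    then show ?R
      by (intro exI[of _ "a - 3"]) (auto simp: d diagonals_def is_diagonal_def)
  qed (use assms in \<open>auto simp: d diagonals_def is_diagonal_def\<close>)
  finally show ?thesis .
qed

lemma f_count_01:
  assumes "N \<ge> 3"
  shows "f_count N 0 1 = card (avoiding {..<N} 2 (N - 3))"
proof -
  have "(\<forall>d\<in>diagonals N. parallel N d 0 1 \<longrightarrow> d \<notin> T)
    \<longleftrightarrow> (\<forall>j<(N - 3) div 2. (2 + j, 2 + (N - 3) - j) \<notin> T)" for T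
  proof -
    have "(\<forall>d\<in>diagonals N. parallel N d 0 1 \<longrightarrow> d \<notin> T)
      \<longleftrightarrow> (\<forall>d. d \<in> diagonals N \<and> parallel N d 0 1 \<longrightarrow> d \<notin> T)"
      by blast
    then show ?thesis
      unfolding parallel_01[OF assms] by auto
  qed
  then show ?thesis
    by (simp only: f_count_eq_card_triangulations avoiding_def)
qed

text \<open>Subtracts the triangulations containing \<open>(0, 2)\<close>: cutting off the ear at
  vertex 1 leaves N - 1 = (N - 4) + 3 vertices, the size that \<open>card_avoiding\<close> handles.
  The additive form avoids truncated subtraction.\<close>

lemma f_count_02:
  assumes "N \<ge> 4"
  shows "f_count N 0 2 + card (avoiding ({..<N} - {1}) 3 (N - 4)) = card (avoiding {..<N} 3 (N - 4))"
proof -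
  let ?Q = "\<lambda>T. \<forall>j<(N - 4) div 2. (3 + j, 3 + (N - 4) - j) \<notin> T"
  let ?V2 = "{..<N} - {0<..<2}"
  have V2: "?V2 = {..<N} - {1}" "{..<N} \<inter> {0..2} = {0, 1, 2}" using assms by auto
  have "(\<forall>d\<in>diagonals N. parallel N d 0 2 \<longrightarrow> d \<notin> T) \<longleftrightarrow> (0, 2) \<notin> T \<and> ?Q T" for T
  proof -
    have "(\<forall>d\<in>diagonals N. parallel N d 0 2 \<longrightarrow> d \<notin> T)
      \<longleftrightarrow> (\<forall>d. d \<in> diagonals N \<and> parallel N d 0 2 \<longrightarrow> d \<notin> T)"
      by blast
    then show ?thesis
      unfolding parallel_02[OF assms] by auto
  qed
  then have f: "f_count N 0 2 = card {T \<in> triangulations {..<N}. (0, 2) \<notin> T \<and> ?Q T}"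
    by (simp only: f_count_eq_card_triangulations)
  have "(3 + j, 3 + (N - 4) - j) \<in> chords ?V2" if "j < (N - 4) div 2" for j
    using that by auto
  \<comment> \<open>The nested chords avoid vertex 1, so the condition depends only on the piece
    left after removing the ear.\<close>
  then have Q: "?Q (T \<inter> chords ?V2) \<longleftrightarrow> ?Q T" for T
    by blast
  have "card {T \<in> triangulations {..<N}. (0, 2) \<in> T \<and> ?Q T}
    = card (triangulations {0, 1, 2}) * card {T \<in> triangulations ?V2. ?Q T}"
    using card_triangulations_split[of 0 "{..<N}" 2 "\<lambda>_. True" ?Q] assms
    unfolding Q V2(2) by simp
  also have "card (triangulations {0, 1, 2}) = 1"
    using card_triangulations[of "{0, 1, 2}" 1] catalan_Suc[of 0] by (simp add: catalan_0)
  finally have g: "card {T \<in> triangulations {..<N}. (0, 2) \<in> T \<and> ?Q T} = card (avoiding ({..<N} - {1}) 3 (N - 4))"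
    by (simp only: V2 avoiding_def mult_1)
  have "card (avoiding {..<N} 3 (N - 4)) = card {T \<in> triangulations {..<N}. (0, 2) \<notin> T \<and> ?Q T}
      + card {T \<in> triangulations {..<N}. (0, 2) \<in> T \<and> ?Q T}"
    unfolding avoiding_def
    by (subst card_Un_disjoint[symmetric]) (auto simp: finite_triangulations intro: arg_cong[where f = card])
  then show ?thesis using f g by simp
qed

section \<open>Evaluation of the three counts\<close>

theorem theorem2:
  shows "(\<forall>n\<ge>2. int (f_count (2*n) 0 1) = 2 * int (catalan (2*n - 3)))
       \<and> (\<forall>n\<ge>2. int (f_count (2*n) 0 2) =
             int (catalan (2*n - 1)) + 2 * int (catalan (2*n - 2)) - 2^(2*n - 1) * int (catalan (n - 1)))
       \<and> (\<forall>n\<ge>1. int (f_count (2*n + 1) 0 1) =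
             2^(2*n - 1) * int (catalan (n - 1)) - int (catalan (2*n - 1)))"
proof (intro conjI allI impI)
  fix n :: nat assume n: "n \<ge> 2"
  have "int (card (avoiding {..<2 * n} 2 (2 * n - 3))) = 2 * int (catalan (2 * n - 3))"
    using n by (subst card_avoiding) auto
  then show "int (f_count (2*n) 0 1) = 2 * int (catalan (2*n - 3))"
    using n f_count_01[of "2 * n"] by simp
next
  fix n :: nat assume "n \<ge> 2"
  then obtain m where n: "n = m + 2" by (metis add.commute le_Suc_ex)
  let ?V = "{..<2 * m + 4}"
  \<comment> \<open>The full polygon has one vertex too many for \<open>card_avoiding\<close>, so
    the innermost chord is split off once by hand; the inner polygons then have the right size, and
    the outer factors get odd index.\<close>
  have summand: "int (card (avoiding {3 + i..3 + 2 * m - i} (3 + i + 1) (2 * m - 2 * i - 2))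
        * catalan (2 * m + 2 - (2 * m - 2 * i - 1)))
      = avoid_odd (m - Suc i) * int (catalan (2 * Suc i + 1))" if "i < m" for i
  proof -
    have "2 * m + 2 - (2 * m - 2 * i - 1) = 2 * Suc i + 1" "2 * m - 2 * i - 2 = 2 * (m - Suc i)"
      using that by auto
    moreover have "int (card (avoiding {3 + i..3 + 2 * m - i} (3 + i + 1) (2 * (m - Suc i))))
        = avoid_odd (m - Suc i)"
      using that by (subst card_avoiding) auto
    ultimately show ?thesis by simp
  qed
  have "{3..3 + 2 * m} \<subseteq> ?V" by auto
  then have "catalan (2 * m + 2) = card (avoiding ?V 3 (2 * m)) + (\<Sum>i<m.
      card (avoiding {3 + i..3 + 2 * m - i} (3 + i + 1) (2 * m - 2 * i - 2))
        * catalan (2 * m + 2 - (2 * m - 2 * i - 1)))"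
    using catalan_eq_sum_avoiding[of ?V 3 "2 * m" "2 * m + 2"] by simp
  then have "int (catalan (2 * m + 2)) = int (card (avoiding ?V 3 (2 * m)))
      + (\<Sum>i<m. int (card (avoiding {3 + i..3 + 2 * m - i} (3 + i + 1) (2 * m - 2 * i - 2))
        * catalan (2 * m + 2 - (2 * m - 2 * i - 1))))"
    by (simp only: of_nat_add of_nat_sum)
  also have "(\<Sum>i<m. int (card (avoiding {3 + i..3 + 2 * m - i} (3 + i + 1) (2 * m - 2 * i - 2))
        * catalan (2 * m + 2 - (2 * m - 2 * i - 1))))
      = (\<Sum>i<m. avoid_odd (m - Suc i) * int (catalan (2 * Suc i + 1)))"
    by (rule sum.cong[OF refl], rule summand) simp
  finally have "int (catalan (2 * m + 2)) = int (card (avoiding ?V 3 (2 * m)))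
      + (\<Sum>i<m. avoid_odd (m - Suc i) * int (catalan (2 * Suc i + 1)))" .
  moreover have "int (card (avoiding (?V - {1}) 3 (2 * m))) = avoid_odd m"
    by (subst card_avoiding) auto
  moreover have "int (f_count (2 * n) 0 2)
      = int (card (avoiding ?V 3 (2 * m))) - int (card (avoiding (?V - {1}) 3 (2 * m)))"
  proof -
    have "2 * n = 2 * m + 4" using n by simp
    then show ?thesis using f_count_02[of "2 * m + 4"] by simp
  qed
  moreover have "catalan 1 = 1" using catalan_Suc[of 0] by (simp add: catalan_0)
  \<comment> \<open>The triangulations with \<open>(0, 2)\<close> number
    \<open>avoid_odd m * catalan 1\<close>, precisely the missing index-0 term; subtracting them
    completes the convolution.\<close>
  ultimately have "int (f_count (2 * n) 0 2) = int (catalan (2 * m + 2))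
      - (\<Sum>i\<le>m. avoid_odd (m - i) * int (catalan (2 * i + 1)))"
    by (simp add: sum.atMost_shift)
  moreover have "(2 :: int) ^ (2 * n - 1) = 2 * 4 ^ Suc m"
  proof -
    have "2 * n - 1 = Suc (2 * Suc m)" using n by simp
    then show ?thesis by (simp only: power_Suc power_mult) simp
  qed
  moreover have "2 * n - 1 = 2 * m + 3" "2 * n - 2 = 2 * m + 2" "n - 1 = Suc m"
    using n by auto
  ultimately show "int (f_count (2*n) 0 2) =
      int (catalan (2*n - 1)) + 2 * int (catalan (2*n - 2)) - 2^(2*n - 1) * int (catalan (n - 1))"
    by (simp only: avoid_odd_conv_odd)
next
  fix n :: nat assume "n \<ge> 1"
  then obtain m where n: "n = m + 1" by (metis add.commute le_Suc_ex)
  have "int (card (avoiding {..<2 * m + 3} 2 (2 * m))) = avoid_odd m"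
    by (subst card_avoiding) auto
  moreover have "f_count (2 * n + 1) 0 1 = card (avoiding {..<2 * m + 3} 2 (2 * m))"
  proof -
    have "2 * n + 1 = 2 * m + 3" using n by simp
    then show ?thesis using f_count_01[of "2 * m + 3"] by (simp only:) simp
  qed
  moreover have "(2 :: int) ^ (2 * n - 1) = 2 * 4 ^ m"
  proof -
    have "2 * n - 1 = Suc (2 * m)" using n by simp
    then show ?thesis by (simp only: power_Suc power_mult) simp
  qed
  ultimately show "int (f_count (2*n + 1) 0 1) =
      2^(2*n - 1) * int (catalan (n - 1)) - int (catalan (2*n - 1))"
    by (simp add: n avoid_odd_def)
qed

end
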